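(* Let $\mu,\nu>0$. The unique equilibrium solution in $\mathcal S_{\mu,\nu}$ of the system $\frac{\mathrm d}{\mathrm dt}\mathbf p=Q_2[\mathbf p]$ (i.e. the unique $\mathbf p\in\mathcal S_{\mu,\nu}$ with $Q_2[\mathbf p]_n=0$ for all $n\in\mathbb Z$), denoted $\mathbf p^*=\{p_n^*\}_{n\in\mathbb Z}$, is given by $$p_n^*=\left(\frac{r^*}{r^*+p_0^*}\right)^n p_0^*,\quad n\ge0,\qquad p_n^*=\left(\frac{d^*}{d^*+p_0^*}\right)^{-n}p_0^*,\quad n\le0,$$ in which $$p_0^*=\begin{cases}\dfrac{1}{4\nu+2}, & \mu=1,\\[8pt] \dfrac{\mu(\nu+\frac12)-\sqrt{\mu^2\nu^2+\mu^2\nu+\frac14}}{(\mu^2-1)/2}, & \mu\ne1,\end{cases}$$ $$r^*=\frac{(\mu-1)\,p_0^*+1}{2},\qquad d^*=1-p_0^*-r^*.$$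
   Context: For $\mu,\nu>0$, $\mathcal S_{\mu,\nu}$ is the set of sequences $\mathbf p=\{p_n\}_{n\in\mathbb Z}$ with $p_n\ge0$, $\sum_{n\in\mathbb Z}p_n=1$, $\sum_{n\in\mathbb Z}n\,p_n=\mu$, and $-\sum_{n\le0}n\,p_n=\mu\nu$. For such $\mathbf p$ put $r=\sum_{n\ge1}p_n$ and $d=\sum_{n\le-1}p_n$ (both are positive), and define $$Q_2[\mathbf p]_n=\begin{cases}\frac{rd}{(r+p_0)(d+p_0)}\,p_{n+1}+\frac{r}{r+p_0}\,p_{n-1}-\left(\frac{rd}{(r+p_0)(d+p_0)}+\frac{r}{r+p_0}\right)p_n, & n\le-1,\\[4pt] p_1+\frac{r}{r+p_0}\,p_{-1}-\left(\frac{rd}{(r+p_0)(d+p_0)}+\frac{r}{r+p_0}\right)p_0, & n=0,\\[4pt] p_{n+1}+\frac{r}{r+p_0}\,p_{n-1}-\left(1+\frac{r}{r+p_0}\right)p_n, & n\ge1.\end{cases}$$ *)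

theory Defs
  imports "HOL-Analysis.Infinite_Sum"
begin

text \<open>On the reals, \<open>has_sum\<close> is unconditional, hence absolute, summation. For the two-sided first
  moment this is no extra requirement: the terms have constant sign on each half-line and the sum
  over \<open>n \<le> 0\<close> is prescribed to be finite.\<close>

definition seq_space :: "real \<Rightarrow> real \<Rightarrow> (int \<Rightarrow> real) set"  (\<open>\<S>\<close>) where
  "\<S> \<mu> \<nu> = {p. (\<forall>n. 0 \<le> p n)
      \<and> (p has_sum 1) UNIV
      \<and> ((\<lambda>n. of_int n * p n) has_sum \<mu>) UNIV
      \<and> ((\<lambda>n. of_int n * p n) has_sum - (\<mu> * \<nu>)) {..0}}"

definition r_mass :: "(int \<Rightarrow> real) \<Rightarrow> real" where
  "r_mass p = (\<Sum>\<^sub>\<infinity>n\<in>{1..}. p n)"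

definition d_mass :: "(int \<Rightarrow> real) \<Rightarrow> real" where
  "d_mass p = (\<Sum>\<^sub>\<infinity>n\<in>{..-1}. p n)"

text \<open>On \<^term>\<open>\<S> \<mu> \<nu>\<close> with positive parameters both masses are positive, so no denominator below
  vanishes there, even when \<^term>\<open>p 0 = 0\<close>.\<close>

definition Q2 :: "(int \<Rightarrow> real) \<Rightarrow> int \<Rightarrow> real" where
  "Q2 p n = (let r = r_mass p; d = d_mass p;
                 a = r / (r + p 0);
                 c = r * d / ((r + p 0) * (d + p 0))
             in if n \<le> -1 then c * p (n + 1) + a * p (n - 1) - (c + a) * p n
                else if n = 0 then p 1 + a * p (-1) - (c + a) * p 0
                else p (n + 1) + a * p (n - 1) - (1 + a) * p n)"

definition is_equilibrium :: "real \<Rightarrow> real \<Rightarrow> (int \<Rightarrow> real) \<Rightarrow> bool" where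
  "is_equilibrium \<mu> \<nu> p \<longleftrightarrow> p \<in> \<S> \<mu> \<nu> \<and> (\<forall>n. Q2 p n = 0)"

definition p0_star :: "real \<Rightarrow> real \<Rightarrow> real" where
  "p0_star \<mu> \<nu> =
     (if \<mu> = 1 then 1 / (4 * \<nu> + 2)
      else (\<mu> * (\<nu> + 1/2) - sqrt (\<mu>\<^sup>2 * \<nu>\<^sup>2 + \<mu>\<^sup>2 * \<nu> + 1/4)) / ((\<mu>\<^sup>2 - 1) / 2))"

definition r_star :: "real \<Rightarrow> real \<Rightarrow> real" where
  "r_star \<mu> \<nu> = ((\<mu> - 1) * p0_star \<mu> \<nu> + 1) / 2"

definition d_star :: "real \<Rightarrow> real \<Rightarrow> real" where
  "d_star \<mu> \<nu> = 1 - p0_star \<mu> \<nu> - r_star \<mu> \<nu>"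

end

theory Submission
  imports Defs
begin

text \<open>
  For \<open>n \<ge> 1\<close> the equilibrium equation says that \<open>p (n + 1) - a * p n\<close> does not depend on \<open>n\<close>, where
  \<open>a = r / (r + p 0)\<close>; since \<open>p\<close> is summable this constant is \<open>0\<close>. The same happens on the negative
  half-line with ratio \<open>b = d / (d + p 0)\<close>, so equilibria are two-sided geometric sequences, and for
  those the equation at \<open>0\<close> and the identities defining \<open>r\<close> and \<open>d\<close> hold automatically.
  Only the mass and the two moments remain to be matched. They give \<open>r - d = \<mu> * p 0\<close>,
  \<open>r + d = 1 - p 0\<close> and a quadratic equation for \<open>p 0\<close>, whose only root with \<open>d > 0\<close> is
  \<open>p0_star \<mu> \<nu>\<close>.
\<close>

section \<open>Two-sided geometric sequences\<close>

lemma has_sum_int_atLeast1_iff: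
  fixes f :: "int \<Rightarrow> real"
  shows "(f has_sum s) {1..} \<longleftrightarrow> ((\<lambda>n. f (int (Suc n))) has_sum s) UNIV"
proof (rule has_sum_reindex_bij_witness[where i = "\<lambda>n. int (Suc n)" and j = "\<lambda>n. nat (n - 1)"])
qed auto

lemma has_sum_int_atMost_minus1_iff:
  fixes f :: "int \<Rightarrow> real"
  shows "(f has_sum s) {..-1} \<longleftrightarrow> ((\<lambda>n. f (- n)) has_sum s) {1..}"
  by (rule has_sum_reindex_bij_witness[where i = uminus and j = uminus]) auto

lemma int_partition: "UNIV = {..-1} \<union> {0} \<union> {1::int..}"
  by auto

lemma atMost0_partition: "{..0} = {..-1} \<union> {0::int}"
  by auto

text \<open>Reindexing from \<open>1\<close> to the naturals pulls out one factor \<open>a\<close>,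
  which leaves the geometric series and its derivative. Nonnegative terms make these ordinary sums
  unconditional.\<close>

lemma
  fixes a x :: real
  assumes "0 \<le> a" "a < 1" "0 \<le> x"
  shows has_sum_geometric_tail:
      "((\<lambda>n::int. x * a ^ nat n) has_sum x * a / (1 - a)) {1..}"
    and has_sum_geometric_tail_moment:
      "((\<lambda>n::int. of_int n * (x * a ^ nat n)) has_sum x * a / (1 - a)\<^sup>2) {1..}"
proof -
  have "(\<lambda>n. a ^ n) sums (1 / (1 - a))"
    using assms by (intro geometric_sums) auto
  from sums_mult[OF this, of "x * a"]
  have "(\<lambda>n. x * a ^ Suc n) sums (x * a / (1 - a))"
    by (simp add: mult_ac)
  hence "((\<lambda>n. x * a ^ Suc n) has_sum x * a / (1 - a)) UNIV"
    using assms by (intro sums_nonneg_imp_has_sum) auto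
  thus "((\<lambda>n::int. x * a ^ nat n) has_sum x * a / (1 - a)) {1..}"
    by (simp add: has_sum_int_atLeast1_iff nat_add_distrib)
  have "(\<lambda>n. of_nat (Suc n) * a ^ n) sums (1 / (1 - a)\<^sup>2)"
    using assms by (intro geometric_deriv_sums) auto
  from sums_mult[OF this, of "x * a"]
  have "(\<lambda>n. real (Suc n) * (x * a ^ Suc n)) sums (x * a / (1 - a)\<^sup>2)"
    by (simp add: mult_ac)
  hence "((\<lambda>n. real (Suc n) * (x * a ^ Suc n)) has_sum x * a / (1 - a)\<^sup>2) UNIV"
    using assms by (intro sums_nonneg_imp_has_sum) auto
  thus "((\<lambda>n::int. of_int n * (x * a ^ nat n)) has_sum x * a / (1 - a)\<^sup>2) {1..}"
    by (simp add: has_sum_int_atLeast1_iff nat_add_distrib)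
qed

definition two_sided_geometric :: "real \<Rightarrow> real \<Rightarrow> real \<Rightarrow> int \<Rightarrow> real" where
  "two_sided_geometric x a b n = (if 0 \<le> n then x * a ^ nat n else x * b ^ nat (- n))"

lemma two_sided_geometric_0 [simp]: "two_sided_geometric x a b 0 = x"
  by (simp add: two_sided_geometric_def)

lemma
  fixes a b x :: real
  assumes a: "0 \<le> a" "a < 1" and b: "0 \<le> b" "b < 1" and x: "0 \<le> x"
  defines "p \<equiv> two_sided_geometric x a b"
  shows has_sum_two_sided_geometric_pos: "(p has_sum x * a / (1 - a)) {1..}"
    and has_sum_two_sided_geometric_neg: "(p has_sum x * b / (1 - b)) {..-1}"
    and has_sum_two_sided_geometric: "(p has_sum x * b / (1 - b) + x + x * a / (1 - a)) UNIV"
    and has_sum_two_sided_geometric_moment_nonpos: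
      "((\<lambda>n. of_int n * p n) has_sum - (x * b / (1 - b)\<^sup>2)) {..0}"
    and has_sum_two_sided_geometric_moment:
      "((\<lambda>n. of_int n * p n) has_sum x * a / (1 - a)\<^sup>2 - x * b / (1 - b)\<^sup>2) UNIV"
proof -
  have "(p has_sum x * a / (1 - a)) {1..} \<longleftrightarrow>
      ((\<lambda>n::int. x * a ^ nat n) has_sum x * a / (1 - a)) {1..}"
    by (rule has_sum_cong) (simp add: p_def two_sided_geometric_def)
  thus pos: "(p has_sum x * a / (1 - a)) {1..}"
    using has_sum_geometric_tail[OF a x] by simp
  have "((\<lambda>n. p (- n)) has_sum x * b / (1 - b)) {1..} \<longleftrightarrow>
      ((\<lambda>n::int. x * b ^ nat n) has_sum x * b / (1 - b)) {1..}"
    by (rule has_sum_cong) (simp add: p_def two_sided_geometric_def)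
  thus neg: "(p has_sum x * b / (1 - b)) {..-1}"
    using has_sum_geometric_tail[OF b x] by (simp add: has_sum_int_atMost_minus1_iff)
  have "(p has_sum p 0) {0}"
    by (simp add: has_sum_finite_iff)
  hence zero: "(p has_sum x) {0}"
    by (simp add: p_def)
  show "(p has_sum x * b / (1 - b) + x + x * a / (1 - a)) UNIV"
    unfolding int_partition by (intro has_sum_Un_disjoint pos neg zero) auto
  have "((\<lambda>n. of_int n * p n) has_sum x * a / (1 - a)\<^sup>2) {1..} \<longleftrightarrow>
      ((\<lambda>n::int. of_int n * (x * a ^ nat n)) has_sum x * a / (1 - a)\<^sup>2) {1..}"
    by (rule has_sum_cong) (simp add: p_def two_sided_geometric_def)
  hence pos': "((\<lambda>n. of_int n * p n) has_sum x * a / (1 - a)\<^sup>2) {1..}"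
    using has_sum_geometric_tail_moment[OF a x] by simp
  have "((\<lambda>n. of_int (- n) * p (- n)) has_sum - (x * b / (1 - b)\<^sup>2)) {1..} \<longleftrightarrow>
      ((\<lambda>n::int. - (of_int n * (x * b ^ nat n))) has_sum - (x * b / (1 - b)\<^sup>2)) {1..}"
    by (rule has_sum_cong) (simp add: p_def two_sided_geometric_def)
  hence neg': "((\<lambda>n. of_int n * p n) has_sum - (x * b / (1 - b)\<^sup>2)) {..-1}"
    unfolding has_sum_int_atMost_minus1_iff
    using has_sum_uminusI[OF has_sum_geometric_tail_moment[OF b x]] by simp
  have zero': "((\<lambda>n. of_int n * p n) has_sum 0) {0}"
    by (simp add: has_sum_finite_iff)
  have "((\<lambda>n. of_int n * p n) has_sum - (x * b / (1 - b)\<^sup>2) + 0) {..0}"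
    unfolding atMost0_partition by (intro has_sum_Un_disjoint neg' zero') auto
  thus "((\<lambda>n. of_int n * p n) has_sum - (x * b / (1 - b)\<^sup>2)) {..0}"
    by simp
  have "((\<lambda>n. of_int n * p n) has_sum - (x * b / (1 - b)\<^sup>2) + 0 + x * a / (1 - a)\<^sup>2) UNIV"
    unfolding int_partition by (intro has_sum_Un_disjoint pos' neg' zero') auto
  thus "((\<lambda>n. of_int n * p n) has_sum x * a / (1 - a)\<^sup>2 - x * b / (1 - b)\<^sup>2) UNIV"
    by simp
qed

text \<open>Since \<open>1 - a = x / (r + x)\<close>, a geometric tail with this ratio has mass
  exactly \<open>r\<close>: the ratio is consistent with the mass that defines it. The lemma serves
  both half-lines, with \<open>d\<close> in place of \<open>r\<close> on the negative one.\<close>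

lemma geometric_mass_of_ratio:
  fixes r x :: real
  assumes "r > 0" "x > 0"
  defines "a \<equiv> r / (r + x)"
  shows "0 \<le> a" "a < 1" "x * a / (1 - a) = r" "x * a / (1 - a)\<^sup>2 = r * (r + x) / x"
proof -
  have a: "1 - a = x / (r + x)"
    using assms by (simp add: a_def field_simps)
  show "0 \<le> a" "a < 1"
    using assms by (simp_all add: a_def)
  show "x * a / (1 - a) = r" "x * a / (1 - a)\<^sup>2 = r * (r + x) / x"
    unfolding a using assms by (simp_all add: a_def power2_eq_square)
qed

section \<open>The quadratic equation for the central mass\<close>

text \<open>Rationalising with the conjugate \<open>A + S\<close> cancels the factor
  \<open>A - S\<close> hidden in \<open>\<mu>\<^sup>2 - 1\<close>. The result has no singularity at
  \<open>\<mu> = 1\<close>, so the case split disappears.\<close>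

lemma p0_star_eq:
  assumes "\<mu> > 0" "\<nu> > 0"
  shows "p0_star \<mu> \<nu> = 1 / (2 * (\<mu> * (\<nu> + 1/2) + sqrt (\<mu>\<^sup>2 * \<nu>\<^sup>2 + \<mu>\<^sup>2 * \<nu> + 1/4)))"
proof -
  define A where "A = \<mu> * (\<nu> + 1/2)"
  define S where "S = sqrt (\<mu>\<^sup>2 * \<nu>\<^sup>2 + \<mu>\<^sup>2 * \<nu> + 1/4)"
  have "A > 0" "S > 0"
    using assms by (auto simp: A_def S_def intro!: mult_pos_pos add_nonneg_pos)
  have S2: "S\<^sup>2 = \<mu>\<^sup>2 * \<nu>\<^sup>2 + \<mu>\<^sup>2 * \<nu> + 1/4"
    using assms by (simp add: S_def)
  have *: "\<mu>\<^sup>2 - 1 = 4 * ((A - S) * (A + S))"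
    using S2 by (simp add: A_def algebra_simps power2_eq_square)
  show ?thesis
  proof (cases "\<mu> = 1")
    case True
    hence "A = S"
      using * \<open>A > 0\<close> \<open>S > 0\<close> by simp
    thus ?thesis
      using True unfolding S_def[symmetric] A_def[symmetric]
      by (simp add: p0_star_def A_def algebra_simps)
  next
    case False
    \<comment> \<open>Otherwise \<open>\<mu>\<^sup>2 = 1\<close>, and \<open>\<mu> > 0\<close>
      leaves only the excluded value \<open>1\<close>.\<close>
    hence "A - S \<noteq> 0"
      using * assms power2_eq_1_iff[of \<mu>] by auto
    thus ?thesis
      using False \<open>A > 0\<close> \<open>S > 0\<close> unfolding S_def[symmetric] A_def[symmetric]
      by (simp add: p0_star_def S_def[symmetric] A_def[symmetric] *)
  qed
qed

lemma
  assumes "\<mu> > 0" "\<nu> > 0"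
  shows p0_star_pos: "p0_star \<mu> \<nu> > 0"
    and r_star_pos: "r_star \<mu> \<nu> > 0"
    and d_star_pos: "d_star \<mu> \<nu> > 0"
    and d_star_quadratic: "d_star \<mu> \<nu> * (d_star \<mu> \<nu> + p0_star \<mu> \<nu>) = \<mu> * \<nu> * p0_star \<mu> \<nu>"
proof -
  define S where "S = sqrt (\<mu>\<^sup>2 * \<nu>\<^sup>2 + \<mu>\<^sup>2 * \<nu> + 1/4)"
  define y where "y = 2 * (\<mu> * (\<nu> + 1/2) + S)"
  have x: "p0_star \<mu> \<nu> = 1 / y"
    using p0_star_eq[OF assms] by (simp add: y_def S_def)
  have S2: "S\<^sup>2 = \<mu>\<^sup>2 * \<nu>\<^sup>2 + \<mu>\<^sup>2 * \<nu> + 1/4"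
    using assms by (simp add: S_def)
  \<comment> \<open>With \<open>y = 2 * \<mu> * \<nu> + \<mu> + 2 * S\<close>, this bound yields
    \<open>y > \<mu> + 1\<close>, which is exactly positivity of \<open>d_star\<close>.\<close>
  have "S \<ge> 1/2"
    unfolding S_def using assms
    by (intro real_le_rsqrt) (simp add: power2_eq_square)
  moreover have "\<mu> * \<nu> > 0"
    using assms by simp
  ultimately have y: "y > \<mu> + 1"
    by (simp add: y_def algebra_simps)
  show "p0_star \<mu> \<nu> > 0"
    using x y assms by simp
  have r: "r_star \<mu> \<nu> = (\<mu> - 1 + y) / (2 * y)"
    using y assms by (simp add: r_star_def x field_simps)
  have d: "d_star \<mu> \<nu> = (y - (\<mu> + 1)) / (2 * y)"
    using y assms by (simp add: d_star_def r x field_simps)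
  show "r_star \<mu> \<nu> > 0" "d_star \<mu> \<nu> > 0"
    using y assms by (simp_all add: r d)
  \<comment> \<open>The two factors on the left are \<open>2 * y * d_star \<mu> \<nu>\<close> and
    \<open>2 * y * (d_star \<mu> \<nu> + p0_star \<mu> \<nu>)\<close>.\<close>
  have "(y - (\<mu> + 1)) * (y - (\<mu> - 1)) = 4 * \<mu> * \<nu> * y"
    using S2 by (simp add: y_def algebra_simps power2_eq_square)
  thus "d_star \<mu> \<nu> * (d_star \<mu> \<nu> + p0_star \<mu> \<nu>) = \<mu> * \<nu> * p0_star \<mu> \<nu>"
    using y assms by (simp add: x d divide_simps) (simp add: algebra_simps)
qed

text \<open>The two quadratic hypotheses are the half-line moments of a geometric sequence,
  multiplied by \<open>x\<close>. Their difference factors through the total mass, so it is linear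
  and fixes \<open>r\<close> and \<open>d\<close> in terms of \<open>x\<close>.\<close>

lemma star_unique:
  assumes "\<mu> > 0" "\<nu> > 0"
    and pos: "x > 0" "d > 0" and mass: "r + d + x = 1"
    and d_eq: "d * (d + x) = \<mu> * \<nu> * x" and r_eq: "r * (r + x) = (\<mu> + \<mu> * \<nu>) * x"
  shows "x = p0_star \<mu> \<nu>" "r = r_star \<mu> \<nu>" "d = d_star \<mu> \<nu>"
proof -
  have "r * (r + x) - d * (d + x) = (r - d) * (r + d + x)"
    by (simp add: algebra_simps)
  also have "r + d + x = 1"
    by (fact mass)
  finally have rd: "r - d = \<mu> * x"
    unfolding d_eq r_eq by (simp add: algebra_simps)
  have r: "r = ((\<mu> - 1) * x + 1) / 2" and d: "d = (1 - (\<mu> + 1) * x) / 2"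
    using rd mass by (simp_all add: field_simps)
  define S where "S = sqrt (\<mu>\<^sup>2 * \<nu>\<^sup>2 + \<mu>\<^sup>2 * \<nu> + 1/4)"
  define A where "A = \<mu> * (\<nu> + 1/2)"
  \<comment> \<open>The quadratic for \<open>x\<close> has leading coefficient
    \<open>\<mu>\<^sup>2 - 1\<close> and degenerates at \<open>\<mu> = 1\<close>; the one for the
    reciprocal is monic.\<close>
  define y where "y = 1 / x"
  have y: "x = 1 / y" "y > 0"
    using pos by (auto simp: y_def)
  have S2: "S\<^sup>2 = \<mu>\<^sup>2 * \<nu>\<^sup>2 + \<mu>\<^sup>2 * \<nu> + 1/4"
    using assms by (simp add: S_def)
  have "(1 - (\<mu> + 1) * x) * (1 - (\<mu> - 1) * x) = 4 * \<mu> * \<nu> * x"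
    using d_eq unfolding d by (simp add: field_simps)
  hence "(y - (\<mu> + 1)) * (y - (\<mu> - 1)) = 4 * \<mu> * \<nu> * y"
    using y(2) unfolding y(1) by (simp add: divide_simps)
  hence "(y - 2 * A)\<^sup>2 = (2 * S)\<^sup>2"
    unfolding power_mult_distrib S2 by (simp add: A_def algebra_simps power2_eq_square)
  hence "y = 2 * A + 2 * S \<or> y = 2 * A - 2 * S"
    unfolding power2_eq_iff by auto
  \<comment> \<open>The smaller root is at most \<open>\<mu>\<close>, whereas \<open>d > 0\<close>
    means \<open>y > \<mu> + 1\<close>.\<close>
  moreover have "y \<noteq> 2 * A - 2 * S"
  proof -
    have "\<mu> * \<nu> \<le> S"
      unfolding S_def using assms by (intro real_le_rsqrt) (simp add: power_mult_distrib)
    hence "2 * A - 2 * S \<le> \<mu>"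
      by (simp add: A_def algebra_simps)
    moreover have "y > \<mu> + 1"
      using pos(2) y(2) unfolding d y(1) by (simp add: field_simps)
    ultimately show ?thesis by simp
  qed
  ultimately have "y = 2 * (A + S)"
    by simp
  thus x: "x = p0_star \<mu> \<nu>"
    using y p0_star_eq[OF assms(1,2)] by (simp add: A_def S_def)
  show rs: "r = r_star \<mu> \<nu>"
    by (simp add: r x r_star_def)
  show "d = d_star \<mu> \<nu>"
    using mass by (simp add: d_star_def x rs)
qed

section \<open>Equilibria\<close>

text \<open>The coefficient \<open>c\<close> factors as \<open>a * b\<close>, so on the negative
  half-line a common factor \<open>a\<close> splits off and leaves a recurrence in \<open>b\<close>
  alone.\<close>

lemma Q2_eq:
  assumes "a = r_mass p / (r_mass p + p 0)" "b = d_mass p / (d_mass p + p 0)"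
  shows "Q2 p n =
    (if n \<le> -1 then a * b * p (n + 1) + a * p (n - 1) - (a * b + a) * p n
     else if n = 0 then p 1 + a * p (-1) - (a * b + a) * p 0
     else p (n + 1) + a * p (n - 1) - (1 + a) * p n)"
  by (simp add: Q2_def Let_def assms)

text \<open>The characteristic roots are \<open>1\<close> and \<open>a\<close>; decay of
  \<open>u\<close> removes the constant component. Working with the invariant
  \<open>u (Suc n) - a * u n\<close> treats the double root \<open>a = 1\<close> in the same
  way.\<close>

lemma geometric_of_recurrence:
  fixes u :: "nat \<Rightarrow> real"
  assumes lim: "u \<longlonglongrightarrow> 0"
    and rec: "\<And>n. u (Suc (Suc n)) + a * u n - (1 + a) * u (Suc n) = 0"
  shows "u n = u 0 * a ^ n"
proof -
  have const: "u (Suc n) - a * u n = u 1 - a * u 0" for n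
  proof (induction n)
    case (Suc n)
    thus ?case using rec[of n] by (simp add: algebra_simps)
  qed simp
  have "(\<lambda>n. u (Suc n) - a * u n) \<longlonglongrightarrow> 0 - a * 0"
    by (intro tendsto_intros lim LIMSEQ_Suc)
  hence "u 1 - a * u 0 = 0"
    unfolding const by (simp add: LIMSEQ_const_iff)
  hence step: "u (Suc n) = a * u n" for n
    using const[of n] by simp
  show ?thesis
    by (induction n) (simp_all add: step)
qed

section \<open>Decay and positive half-line masses in the sequence space\<close>

lemma seq_space_tendsto:
  assumes "p \<in> \<S> \<mu> \<nu>"
  shows "(\<lambda>n. p (int n)) \<longlonglongrightarrow> 0" "(\<lambda>n. p (- int n)) \<longlonglongrightarrow> 0"
proof -
  have *: "(\<lambda>n. p (f n)) \<longlonglongrightarrow> 0" if "inj f" for f :: "nat \<Rightarrow> int"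
  proof -
    have "p summable_on UNIV"
      using assms by (auto simp: seq_space_def summable_on_def)
    hence "p summable_on range f"
      by (rule summable_on_subset_banach) simp
    hence "(\<lambda>n. p (f n)) summable_on UNIV"
      using summable_on_reindex[OF that, of p] by (simp add: o_def)
    thus ?thesis
      by (intro summable_LIMSEQ_zero summable_on_imp_summable)
  qed
  show "(\<lambda>n. p (int n)) \<longlonglongrightarrow> 0"
    by (intro * injI) simp
  show "(\<lambda>n. p (- int n)) \<longlonglongrightarrow> 0"
    by (intro * injI) simp
qed

text \<open>Zero mass would force every nonnegative term on \<open>A\<close> to vanish, and with
  them the moment \<open>s\<close>.\<close>

lemma infsum_pos_of_weighted:
  fixes p :: "int \<Rightarrow> real"
  assumes "p summable_on A" "\<And>n. 0 \<le> p n" "((\<lambda>n. of_int n * p n) has_sum s) A" "s \<noteq> 0"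
  shows "infsum p A > 0"
proof (rule ccontr)
  assume "\<not> infsum p A > 0"
  hence "p n = 0" if "n \<in> A" for n
    using that assms(1,2) by (intro nonneg_infsum_le_0D[of p A]) auto
  hence "((\<lambda>n. of_int n * p n) has_sum 0) A"
    by (intro has_sum_0) simp
  with assms(3,4) show False
    using has_sum_unique by blast
qed

lemma seq_space_mass_pos:
  assumes "\<mu> > 0" "\<nu> > 0" "p \<in> \<S> \<mu> \<nu>"
  shows "r_mass p > 0" "d_mass p > 0"
proof -
  let ?f = "\<lambda>n. of_int n * p n"
  have nonneg: "\<And>n. 0 \<le> p n" and mom: "(?f has_sum \<mu>) UNIV" "(?f has_sum - (\<mu> * \<nu>)) {..0}"
    using assms by (auto simp: seq_space_def)
  have sum: "p summable_on A" for A
    by (rule summable_on_subset_banach[of _ UNIV])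
      (use assms in \<open>auto simp: seq_space_def summable_on_def\<close>)
  \<comment> \<open>The moment of the positive half-line is \<open>\<mu> + \<mu> * \<nu>\<close>,
    hence nonzero.\<close>
  have "(?f has_sum \<mu> - (- (\<mu> * \<nu>))) (UNIV - {..0})"
    by (intro has_sum_Diff mom) auto
  also have "UNIV - {..0} = {1::int..}"
    by auto
  finally show "r_mass p > 0"
    unfolding r_mass_def using assms
    by (intro infsum_pos_of_weighted[OF sum nonneg]) (auto simp: add_pos_pos less_imp_neq[THEN not_sym])
  have "(?f has_sum ?f 0) {0}"
    by (simp add: has_sum_finite_iff)
  hence "(?f has_sum - (\<mu> * \<nu>) - ?f 0) ({..0} - {0})"
    by (intro has_sum_Diff mom) auto
  also have "{..0} - {0} = {..-1::int}"
    by auto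
  finally show "d_mass p > 0"
    unfolding d_mass_def using assms
    by (intro infsum_pos_of_weighted[OF sum nonneg]) auto
qed

lemma equilibrium_two_sided_geometric:
  assumes "\<mu> > 0" "\<nu> > 0" and eq: "is_equilibrium \<mu> \<nu> p"
  shows "p = two_sided_geometric (p 0) (r_mass p / (r_mass p + p 0)) (d_mass p / (d_mass p + p 0))"
    and "p 0 > 0"
proof -
  define r where "r = r_mass p"
  define d where "d = d_mass p"
  define a where "a = r / (r + p 0)"
  define b where "b = d / (d + p 0)"
  have S: "p \<in> \<S> \<mu> \<nu>" and Q: "\<And>n. Q2 p n = 0"
    using eq by (auto simp: is_equilibrium_def)
  have rd: "r > 0" "d > 0"
    using seq_space_mass_pos[OF assms(1,2) S] by (simp_all add: r_def d_def)
  have p0: "p 0 \<ge> 0"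
    using S by (simp add: seq_space_def)
  have "a > 0"
    using rd p0 by (simp add: a_def)
  note Q2_ab = Q2_eq[OF a_def[unfolded r_def] b_def[unfolded d_def]]
  have up: "p (int n) = p 0 * a ^ n" for n
  proof -
    \<comment> \<open>The equation at \<open>Suc n\<close> reaches down to \<open>n\<close>, so the
      recurrence starts at the central value \<open>p 0\<close>. The negative side does too, and
      both branches share that initial value.\<close>
    have "p (int (Suc (Suc n))) + a * p (int n) - (1 + a) * p (int (Suc n)) = 0" for n
      using Q[of "int (Suc n)"]
      by (simp add: Q2_ab add_ac)
    from geometric_of_recurrence[OF seq_space_tendsto(1)[OF S] this] show ?thesis
      by simp
  qed
  have down: "p (- int n) = p 0 * b ^ n" for n
  proof -
    have "p (- int (Suc (Suc n))) + b * p (- int n) - (1 + b) * p (- int (Suc n)) = 0" for n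
    proof -
      have "a * b * p (- int n) + a * p (- int (Suc (Suc n))) - (a * b + a) * p (- int (Suc n)) = 0"
        using Q[of "- int (Suc n)"] by (simp add: Q2_ab algebra_simps)
      hence "a * (p (- int (Suc (Suc n))) + b * p (- int n) - (1 + b) * p (- int (Suc n))) = 0"
        by (simp add: algebra_simps)
      thus ?thesis
        using \<open>a > 0\<close> by simp
    qed
    from geometric_of_recurrence[OF seq_space_tendsto(2)[OF S] this] show ?thesis
      by simp
  qed
  have "p n = two_sided_geometric (p 0) a b n" for n
  proof (cases "0 \<le> n")
    case True
    thus ?thesis
      using up[of "nat n"] by (simp add: two_sided_geometric_def)
  next
    case False
    thus ?thesis
      using down[of "nat (- n)"] by (simp add: two_sided_geometric_def)
  qed
  thus "p = two_sided_geometric (p 0) (r_mass p / (r_mass p + p 0)) (d_mass p / (d_mass p + p 0))"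
    unfolding a_def b_def r_def d_def by (rule ext)
  \<comment> \<open>A vanishing central value would wipe out the positive half-line, contradicting
    \<open>r > 0\<close>.\<close>
  have "p 0 \<noteq> 0"
  proof
    assume "p 0 = 0"
    hence "p n = 0" if "n \<in> {1..}" for n
      using up[of "nat n"] that by simp
    hence "r = 0"
      unfolding r_def r_mass_def by (rule infsum_0)
    thus False
      using rd by simp
  qed
  thus "p 0 > 0"
    using p0 by simp
qed

text \<open>Uniqueness of sums equates the mass and moments computed for the geometric form with
  those prescribed by \<open>\<S> \<mu> \<nu>\<close>, which supplies the hypotheses of
  \<open>star_unique\<close>.\<close>

lemma equilibrium_eq_star:
  assumes "\<mu> > 0" "\<nu> > 0" and eq: "is_equilibrium \<mu> \<nu> p"
  shows "p 0 = p0_star \<mu> \<nu>" "r_mass p = r_star \<mu> \<nu>" "d_mass p = d_star \<mu> \<nu>"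
proof -
  define x where "x = p 0"
  define r where "r = r_mass p"
  define d where "d = d_mass p"
  have S: "p \<in> \<S> \<mu> \<nu>"
    using eq by (auto simp: is_equilibrium_def)
  have pos: "r > 0" "d > 0" "x > 0"
    using seq_space_mass_pos[OF assms(1,2) S] equilibrium_two_sided_geometric(2)[OF assms]
    by (simp_all add: r_def d_def x_def)
  have p: "p = two_sided_geometric x (r / (r + x)) (d / (d + x))"
    using equilibrium_two_sided_geometric(1)[OF assms] by (simp add: r_def d_def x_def)
  note R = geometric_mass_of_ratio[OF pos(1,3)]
  note D = geometric_mass_of_ratio[OF pos(2,3)]
  note args = R(1,2) D(1,2) less_imp_le[OF pos(3)]
  have "(p has_sum d + x + r) UNIV"
    using has_sum_two_sided_geometric[OF args] unfolding p[symmetric] R(3) D(3) .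
  moreover have "(p has_sum 1) UNIV"
    using S by (simp add: seq_space_def)
  ultimately have "d + x + r = 1"
    by (rule has_sum_unique)
  hence mass: "r + d + x = 1"
    by simp
  have "((\<lambda>n. of_int n * p n) has_sum - (d * (d + x) / x)) {..0}"
    using has_sum_two_sided_geometric_moment_nonpos[OF args] unfolding p[symmetric] D(4) .
  moreover have "((\<lambda>n. of_int n * p n) has_sum - (\<mu> * \<nu>)) {..0}"
    using S by (simp add: seq_space_def)
  ultimately have "- (d * (d + x) / x) = - (\<mu> * \<nu>)"
    by (rule has_sum_unique)
  hence dm: "d * (d + x) / x = \<mu> * \<nu>"
    by simp
  have "((\<lambda>n. of_int n * p n) has_sum r * (r + x) / x - d * (d + x) / x) UNIV"
    using has_sum_two_sided_geometric_moment[OF args] unfolding p[symmetric] D(4) R(4) .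
  moreover have "((\<lambda>n. of_int n * p n) has_sum \<mu>) UNIV"
    using S by (simp add: seq_space_def)
  ultimately have "r * (r + x) / x - d * (d + x) / x = \<mu>"
    by (rule has_sum_unique)
  hence "r * (r + x) / x = \<mu> + \<mu> * \<nu>"
    unfolding dm by simp
  with dm have "d * (d + x) = \<mu> * \<nu> * x" "r * (r + x) = (\<mu> + \<mu> * \<nu>) * x"
    using pos by (simp_all add: divide_simps)
  from star_unique[OF assms(1,2) pos(3,2) mass this]
  show "p 0 = p0_star \<mu> \<nu>" "r_mass p = r_star \<mu> \<nu>" "d_mass p = d_star \<mu> \<nu>"
    by (simp_all add: x_def r_def d_def)
qed

section \<open>Existence of the equilibrium\<close>

definition p_star :: "real \<Rightarrow> real \<Rightarrow> int \<Rightarrow> real" where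
  "p_star \<mu> \<nu> = two_sided_geometric (p0_star \<mu> \<nu>)
     (r_star \<mu> \<nu> / (r_star \<mu> \<nu> + p0_star \<mu> \<nu>)) (d_star \<mu> \<nu> / (d_star \<mu> \<nu> + p0_star \<mu> \<nu>))"

lemma equilibrium_p_star:
  assumes "\<mu> > 0" "\<nu> > 0"
  shows "is_equilibrium \<mu> \<nu> (p_star \<mu> \<nu>)"
proof -
  define x where "x = p0_star \<mu> \<nu>"
  define r where "r = r_star \<mu> \<nu>"
  define d where "d = d_star \<mu> \<nu>"
  define a where "a = r / (r + x)"
  define b where "b = d / (d + x)"
  define p where "p = p_star \<mu> \<nu>"
  have pos: "r > 0" "d > 0" "x > 0"
    using assms p0_star_pos r_star_pos d_star_pos by (simp_all add: r_def d_def x_def)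
  have p: "p = two_sided_geometric x a b"
    by (simp add: p_star_def x_def r_def d_def a_def b_def p_def)
  note R = geometric_mass_of_ratio[OF pos(1,3), folded a_def]
  note D = geometric_mass_of_ratio[OF pos(2,3), folded b_def]
  note args = R(1,2) D(1,2) less_imp_le[OF pos(3)]
  have mass: "d + x + r = 1"
    by (simp add: d_def x_def r_def d_star_def)
  have rd: "r - d = \<mu> * x"
    by (simp add: d_def x_def r_def d_star_def r_star_def field_simps)
  have dm: "d * (d + x) = \<mu> * \<nu> * x"
    using d_star_quadratic[OF assms] by (simp add: d_def x_def)
  have "r * (r + x) - d * (d + x) = (r - d) * (d + x + r)"
    by (simp add: algebra_simps)
  \<comment> \<open>Divided by \<open>x\<close>, this is the full first moment, while
    \<open>dm\<close> gives the nonpositive one.\<close>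
  hence rm: "r * (r + x) - d * (d + x) = \<mu> * x"
    by (simp add: mass rd)
  have "(p has_sum 1) UNIV"
    using has_sum_two_sided_geometric[OF args] unfolding p[symmetric] R(3) D(3) mass .
  moreover have "((\<lambda>n. of_int n * p n) has_sum - (\<mu> * \<nu>)) {..0}"
    using has_sum_two_sided_geometric_moment_nonpos[OF args] pos
    unfolding p[symmetric] D(4) dm by simp
  moreover have "((\<lambda>n. of_int n * p n) has_sum \<mu>) UNIV"
    using has_sum_two_sided_geometric_moment[OF args] pos
    unfolding p[symmetric] D(4) R(4) diff_divide_distrib[symmetric] rm by simp
  moreover have "0 \<le> p n" for n
    using args by (simp add: p two_sided_geometric_def)
  ultimately have "p \<in> \<S> \<mu> \<nu>"
    by (simp add: seq_space_def)
  moreover have "Q2 p n = 0" for n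
  proof -
    \<comment> \<open>The coefficients of \<open>Q2\<close> depend on \<open>p\<close> through its
      masses, so these must first be identified with the parameters that define the ratios.\<close>
    have m: "r_mass p = r" "d_mass p = d"
      using infsumI[OF has_sum_two_sided_geometric_pos[OF args]]
        infsumI[OF has_sum_two_sided_geometric_neg[OF args]]
      by (simp_all add: r_mass_def d_mass_def p R(3) D(3))
    have "a = r_mass p / (r_mass p + p 0)" "b = d_mass p / (d_mass p + p 0)"
      by (simp_all add: m a_def b_def) (simp_all add: p)
    note Q2_ab = Q2_eq[OF this]
    have up: "p (k + 1) = a * p k" if "k \<ge> 0" for k
      using that by (simp add: p two_sided_geometric_def nat_add_distrib)
    have down: "p (k - 1) = b * p k" if "k \<le> 0" for k
    proof -
      have "nat (1 - k) = Suc (nat (- k))"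
        using that by simp
      thus ?thesis
        \<comment> \<open>At \<open>k = 0\<close> the two values come from different branches of the
          definition.\<close>
        using that by (cases "k = 0") (simp_all add: p two_sided_geometric_def)
    qed
    \<comment> \<open>Detailed balance holds across each pair of neighbours:
      \<open>p (k + 1) = a * p k\<close> for \<open>k \<ge> 0\<close>, and
      \<open>a * p (k - 1) = a * b * p k\<close> for \<open>k \<le> 0\<close>. Gains and losses at
      every site therefore cancel.\<close>
    consider "n \<le> -1" | "n = 0" | "n \<ge> 1" by linarith
    thus ?thesis
    proof cases
      case 1
      thus ?thesis
        using down[of n] down[of "n + 1"]
        by (simp add: Q2_ab algebra_simps)
    next
      case 2
      thus ?thesis
        using up[of 0] down[of 0]
        by (simp add: Q2_ab algebra_simps)
    next
      case 3
      thus ?thesis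
        using up[of n] up[of "n - 1"]
        by (simp add: Q2_ab algebra_simps)
    qed
  qed
  ultimately show ?thesis
    by (simp add: is_equilibrium_def p_def)
qed

lemma equilibrium_iff:
  assumes "\<mu> > 0" "\<nu> > 0"
  shows "is_equilibrium \<mu> \<nu> p \<longleftrightarrow> p = p_star \<mu> \<nu>"
proof
  assume "is_equilibrium \<mu> \<nu> p"
  note eq = assms this
  from equilibrium_two_sided_geometric(1)[OF eq] show "p = p_star \<mu> \<nu>"
    unfolding equilibrium_eq_star[OF eq] p_star_def .
qed (simp add: equilibrium_p_star[OF assms])

theorem proposition3p1:
  fixes \<mu> \<nu> :: real
  assumes "\<mu> > 0" and "\<nu> > 0"
  shows "(\<exists>!p. is_equilibrium \<mu> \<nu> p) \<and>
         (\<forall>p. is_equilibrium \<mu> \<nu> p \<longrightarrow>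
            (\<forall>n\<ge>0. p n = (r_star \<mu> \<nu> / (r_star \<mu> \<nu> + p0_star \<mu> \<nu>)) powi n * p0_star \<mu> \<nu>) \<and>
            (\<forall>n\<le>0. p n = (d_star \<mu> \<nu> / (d_star \<mu> \<nu> + p0_star \<mu> \<nu>)) powi (- n) * p0_star \<mu> \<nu>) \<and>
            r_mass p = r_star \<mu> \<nu> \<and> d_mass p = d_star \<mu> \<nu>)"
proof (intro conjI allI impI)
  show "\<exists>!p. is_equilibrium \<mu> \<nu> p"
    by (simp add: equilibrium_iff[OF assms])
next
  fix p assume eq: "is_equilibrium \<mu> \<nu> p"
  show "r_mass p = r_star \<mu> \<nu>" "d_mass p = d_star \<mu> \<nu>"
    using equilibrium_eq_star[OF assms eq] by simp_all
  have p: "p = p_star \<mu> \<nu>"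
    using eq equilibrium_iff[OF assms] by simp
  show "p n = (r_star \<mu> \<nu> / (r_star \<mu> \<nu> + p0_star \<mu> \<nu>)) powi n * p0_star \<mu> \<nu>" if "n \<ge> 0" for n
    using that by (simp add: p p_star_def two_sided_geometric_def power_int_def)
  \<comment> \<open>At \<open>n = 0\<close> the definition takes the branch with the positive-side
    ratio, but both powers are \<open>1\<close> there.\<close>
  show "p n = (d_star \<mu> \<nu> / (d_star \<mu> \<nu> + p0_star \<mu> \<nu>)) powi (- n) * p0_star \<mu> \<nu>" if "n \<le> 0" for n
    using that by (cases "n = 0") (simp_all add: p p_star_def two_sided_geometric_def power_int_def)
qed

end
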